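(* Let $r\ge1$ be an integer. For every positive integer $n$, $$F^{(r)}_n=\sum_{k=0}^{\lfloor (n-1)/2\rfloor}\frac12\left((-1)^{\left\lfloor\frac{n-1-2k}{2r+1}\right\rfloor}-(-1)^{\left\lfloor\frac{n-2k-3}{2r+1}\right\rfloor}\right)c_{n+r-2,k}=\sum_{k=0}^{\left\lfloor\frac{n-1}{2r+1}\right\rfloor}(-1)^k\,c_{n+r-2,\left\lfloor\frac{n-1-(2r+1)k}{2}\right\rfloor}.$$ For every non-negative integer $n$, $$L^{(r)}_n=(-1)^{n+1}2^{n-1}+(-1)^n\,\frac{2r+1}{2}\sum_{k=0}^n\binom nk\,\delta_{2r+1\mid n-2k},$$ and this equals $$\begin{cases}\displaystyle -2^{2m-1}+\frac{2r+1}{2}\sum_{k=-\left\lfloor\frac{m}{2r+1}\right\rfloor}^{\left\lfloor\frac{m}{2r+1}\right\rfloor}\binom{2m}{m-(2r+1)k} & (n=2m)\\[3mm] \displaystyle 4^m-\frac{2r+1}{2}\sum_{k=-\left\lfloor\frac{m+r+1}{2r+1}\right\rfloor}^{\left\lfloor\frac{m-r}{2r+1}\right\rfloor}\binom{2m+1}{m-(2r+1)k-r} & (n=2m+1).\end{cases}$$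
   Context: For $r\ge1$ put $\alpha_j=-2\cos\left(\frac{2\pi j}{2r+1}\right)$, $j=1,\dots,r$. For $n\ge0$ define $F^{(r)}_{n+1}:=h^{(r)}_n(\alpha_1,\dots,\alpha_r)$ and $L^{(r)}_n:=p^{(r)}_n(\alpha_1,\dots,\alpha_r)$, where $h^{(r)}_n(w_1,\dots,w_r)=\sum_{m_1+\dots+m_r=n}w_1^{m_1}\cdots w_r^{m_r}$ (sum over non-negative integers $m_i$) is the complete homogeneous symmetric polynomial and $p^{(r)}_n(w_1,\dots,w_r)=\sum_{j=1}^r w_j^n$ is the power sum. For an integer $n$, $\binom nk=\frac{n(n-1)\cdots(n-k+1)}{k!}$ for $k\ge1$, $\binom n0=1$, $\binom nk=0$ for $k<0$; $c_{n,k}:=\binom nk-\binom n{k-1}$. $\delta_{2r+1\mid a}$ is $1$ if $2r+1$ divides the integer $a$ and $0$ otherwise. $\lfloor x\rfloor$ is the greatest integer not exceeding $x$. Sums whose upper limit is smaller than their lower limit are empty. *)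

theory Defs
  imports Complex_Main "HOL-Library.FuncSet"
begin

definition exponents :: "nat \<Rightarrow> nat \<Rightarrow> (nat \<Rightarrow> nat) set" where
  "exponents r n = {m \<in> {1..r} \<rightarrow>\<^sub>E UNIV. (\<Sum>j = 1..r. m j) = n}"

(* the sum defining complete_homogeneous is therefore never one over an infinite set *)
lemma finite_exponents: "finite (exponents r n)"
proof (rule finite_subset)
  show "exponents r n \<subseteq> {1..r} \<rightarrow>\<^sub>E {..n}"
  proof
    fix m assume m: "m \<in> exponents r n"
    have "m j \<le> n" if "j \<in> {1..r}" for j
      using m member_le_sum[of j "{1..r}" m] that by (auto simp: exponents_def)
    then show "m \<in> {1..r} \<rightarrow>\<^sub>E {..n}"
      using m by (auto simp: exponents_def PiE_iff)
  qed
qed (simp add: finite_PiE)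

definition complete_homogeneous :: "nat \<Rightarrow> nat \<Rightarrow> (nat \<Rightarrow> real) \<Rightarrow> real" where
  "complete_homogeneous r n w = (\<Sum>m\<in>exponents r n. \<Prod>j = 1..r. w j ^ m j)"

definition power_sum :: "nat \<Rightarrow> nat \<Rightarrow> (nat \<Rightarrow> real) \<Rightarrow> real" where
  "power_sum r n w = (\<Sum>j = 1..r. w j ^ n)"

definition \<alpha> :: "nat \<Rightarrow> nat \<Rightarrow> real" where
  "\<alpha> r j = - 2 * cos (2 * pi * real j / (2 * real r + 1))"

(* meaningful for n >= 1 only; at n = 0 truncated subtraction yields a junk value *)
definition F :: "nat \<Rightarrow> nat \<Rightarrow> real" where
  "F r n = complete_homogeneous r (n - 1) (\<alpha> r)"

definition L :: "nat \<Rightarrow> nat \<Rightarrow> real" where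
  "L r n = power_sum r n (\<alpha> r)"

definition binom :: "int \<Rightarrow> int \<Rightarrow> real" where
  "binom n k = (if k < 0 then 0 else real_of_int n gchoose nat k)"

definition c :: "int \<Rightarrow> int \<Rightarrow> real" where
  "c n k = binom n k - binom n (k - 1)"

end

theory Submission
  imports Defs "HOL-Computational_Algebra.Polynomial_FPS"
begin

text \<open>
  Write \<open>q = 2 r + 1\<close>. Both families of formulas come from the substitution
  \<open>z \<mapsto> z + 1/z\<close>, which turns the numbers \<open>\<alpha>\<^sub>j = - 2 cos (2 \<pi> j / q)\<close> into
  \<open>q\<close>-th roots of unity.

  For \<open>F\<close>, the generating function of the complete homogeneous polynomials is
  \<open>1 / \<Prod>\<^sub>j (1 - w\<^sub>j t)\<close>. Putting \<open>t = x / (1 + x\<^sup>2)\<close> and applying Lagrange inversion shows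
  that \<open>h\<^sub>n(w\<^sub>1, \<dots>, w\<^sub>s)\<close> is the coefficient of \<open>x\<^sup>n\<close> in
  \<open>(1 + x\<^sup>2)\<^bsup>n + s - 1\<^esup> (1 - x\<^sup>2) / \<Prod>\<^sub>j (1 + x\<^sup>2 - w\<^sub>j x)\<close>. This holds for all \<open>w\<close> and is proved
  in \<open>complete_homogeneous_nth\<close> without inversion: both sides obey the recurrence
  \<open>h\<^sub>n(w\<^sub>1, \<dots>, w\<^sub>s) = h\<^sub>n(w\<^sub>1, \<dots>, w\<^sub>s\<^sub>-\<^sub>1) + w\<^sub>s h\<^sub>n\<^sub>-\<^sub>1(w\<^sub>1, \<dots>, w\<^sub>s)\<close>.
  For \<open>w = \<alpha>\<close> the denominator is \<open>(1 + x\<^sup>q) / (1 + x)\<close> (\<open>cyclotomic_product\<close>), since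
  \<open>1 + x\<^sup>2 - \<alpha>\<^sub>j x\<close> has as its zeros the negatives of a conjugate pair of \<open>q\<close>-th roots of
  unity. The series \<open>(1 + x) / (1 + x\<^sup>q)\<close> has coefficients \<open>\<plusminus>1\<close> at the exponents congruent
  to 0 or 1 modulo \<open>q\<close>, and \<open>(1 + x\<^sup>2)\<^sup>N (1 - x\<^sup>2) = \<Sum>\<^sub>k c\<^sub>N\<^sub>,\<^sub>k x\<^bsup>2 k\<^esup>\<close>. The Cauchy product of these
  two series, summed over all \<open>k\<close>, is the first formula for \<open>F\<close>; summed over the nonzero
  coefficients of the periodic factor only, it is the second.

  For \<open>L\<close>, expand \<open>(2 cos \<theta>)\<^sup>n = (e\<^bsup>i\<theta>\<^esup> + e\<^bsup>-i\<theta>\<^esup>)\<^sup>n\<close> by the binomial theorem and sum over the \<open>q\<close>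
  angles \<open>2 \<pi> j / q\<close>: orthogonality of the roots of unity keeps exactly the terms with
  \<open>q dvd n - 2 k\<close> (\<open>sum_cosine_powers\<close>). The angle 0 contributes \<open>2\<^sup>n\<close>, and the others
  occur in pairs \<open>\<plusminus>\<theta>\<close> of equal cosine, so that together they contribute \<open>2 (-1)\<^sup>n L\<^sub>n\<close>.
  As \<open>q\<close> is odd, \<open>q dvd n - 2 k\<close> says that \<open>k\<close> lies in one residue class modulo \<open>q\<close>, and listing that class gives the two parity cases.
\<close>

unbundle fps_syntax

section \<open>Complete homogeneous polynomials as coefficients\<close>

lemma complete_homogeneous_degree_0: "complete_homogeneous s 0 w = 1"
proof -
  have "exponents s 0 = {\<lambda>j\<in>{1..s}. 0}"
    by (auto simp: exponents_def PiE_iff extensional_def restrict_def fun_eq_iff)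
  then show ?thesis
    by (simp add: complete_homogeneous_def)
qed

lemma complete_homogeneous_no_variables: "complete_homogeneous 0 (Suc n) w = 0"
  by (simp add: complete_homogeneous_def exponents_def)

text \<open>
  A monomial of degree \<open>n + 1\<close> either avoids the last variable or has a factor of it that can
  be removed.
\<close>

lemma complete_homogeneous_Suc_Suc:
  "complete_homogeneous (Suc s) (Suc n) w =
     complete_homogeneous s (Suc n) w + w (Suc s) * complete_homogeneous (Suc s) n w"
proof -
  define E where "E = exponents (Suc s) (Suc n)"
  define f where "f m = (\<Prod>j = 1..Suc s. w j ^ m j)" for m :: "nat \<Rightarrow> nat"
  have absent: "(\<Sum>m\<in>{m\<in>E. m (Suc s) = 0}. f m) = complete_homogeneous s (Suc n) w"
    unfolding complete_homogeneous_def
    \<comment> \<open>An exponent vector for \<open>s\<close> variables takes the default value outside \<open>{1..s}\<close>.\<close>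
  proof (rule sum.reindex_bij_witness[where i = "\<lambda>m. m(Suc s := 0)" and
        j = "\<lambda>m. m(Suc s := undefined)"], goal_cases)
    case (3 m)
    then show ?case
      by (auto simp: E_def exponents_def PiE_iff extensional_def fun_eq_iff)
  next
    case (4 m)
    then show ?case
      by (auto simp: E_def exponents_def PiE_iff extensional_def)
  qed (auto simp: E_def exponents_def PiE_iff extensional_def fun_eq_iff f_def)
  have "(\<Sum>m\<in>{m\<in>E. m (Suc s) \<noteq> 0}. f m) =
        (\<Sum>m\<in>exponents (Suc s) n. w (Suc s) * f m)"
  proof (rule sum.reindex_bij_witness[where i = "\<lambda>m. m(Suc s := Suc (m (Suc s)))" and
        j = "\<lambda>m. m(Suc s := m (Suc s) - 1)"], goal_cases)
    case (5 m)
    then obtain k where "m (Suc s) = Suc k"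
      using not0_implies_Suc by auto
    then show ?case by (simp add: f_def)
  qed (auto simp: E_def exponents_def PiE_iff extensional_def)
  then have present: "(\<Sum>m\<in>{m\<in>E. m (Suc s) \<noteq> 0}. f m) =
        w (Suc s) * complete_homogeneous (Suc s) n w"
    by (simp add: complete_homogeneous_def f_def sum_distrib_left)
  have "complete_homogeneous (Suc s) (Suc n) w = sum f E"
    by (simp add: complete_homogeneous_def E_def f_def)
  also have "E = {m\<in>E. m (Suc s) = 0} \<union> {m\<in>E. m (Suc s) \<noteq> 0}"
    by auto
  also have "sum f \<dots> = (\<Sum>m\<in>{m\<in>E. m (Suc s) = 0}. f m) + (\<Sum>m\<in>{m\<in>E. m (Suc s) \<noteq> 0}. f m)"
    by (rule sum.union_disjoint) (auto simp: E_def finite_exponents)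
  finally show ?thesis
    by (simp only: absent present)
qed

lemma binom_nat: "binom (int n) (int k) = real (n choose k)"
  by (simp add: binom_def binomial_gbinomial)

lemma one_plus_X_squared_power_nth:
  "((1 + fps_X ^ 2) ^ N :: real fps) $ m = (if even m then real (N choose (m div 2)) else 0)"
proof (induction N arbitrary: m)
  case 0
  then show ?case by (auto elim!: evenE)
next
  case (Suc N)
  have "((1 + fps_X ^ 2) ^ Suc N :: real fps) $ m =
      (1 + fps_X ^ 2) ^ N $ m + (if m < 2 then 0 else (1 + fps_X ^ 2) ^ N $ (m - 2))"
    by (simp add: algebra_simps fps_X_power_mult_nth)
  also have "\<dots> = (if even m then real (Suc N choose (m div 2)) else 0)"
  proof (cases "m < 2")
    case True
    then have "m = 0 \<or> m = 1" by auto
    then show ?thesis by (auto simp: Suc.IH)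
  next
    case False
    then obtain l where "m = Suc (Suc l)"
      by (metis add_2_eq_Suc le_add_diff_inverse not_less)
    then show ?thesis by (simp add: Suc.IH)
  qed
  finally show ?case .
qed

lemma c_nth:
  "((1 + fps_X ^ 2) ^ N * (1 - fps_X ^ 2) :: real fps) $ m =
     (if even m then c (int N) (int (m div 2)) else 0)"
proof -
  have "(A * (1 - fps_X ^ 2)) $ m = A $ m - (if m < 2 then 0 else A $ (m - 2))"
    for A :: "real fps"
    by (simp add: right_diff_distrib fps_X_power_mult_right_nth)
  then have "((1 + fps_X ^ 2) ^ N * (1 - fps_X ^ 2) :: real fps) $ m =
      (1 + fps_X ^ 2) ^ N $ m - (if m < 2 then 0 else (1 + fps_X ^ 2) ^ N $ (m - 2))" .
  also have "\<dots> = (if even m then c (int N) (int (m div 2)) else 0)"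
  proof (cases "m < 2")
    case True
    then have "m = 0 \<or> m = 1" by auto
    then show ?thesis by (auto simp: one_plus_X_squared_power_nth c_def binom_def)
  next
    case False
    then obtain l where m: "m = Suc (Suc l)"
      by (metis add_2_eq_Suc le_add_diff_inverse not_less)
    have "c (int N) (int (Suc k)) = real (N choose Suc k) - real (N choose k)" for k
      using binom_nat[of N "Suc k"] binom_nat[of N k] by (simp add: c_def)
    then show ?thesis by (simp add: one_plus_X_squared_power_nth m)
  qed
  finally show ?thesis .
qed

text \<open>
  By the symmetry of the binomial coefficients the two terms of \<open>c\<^sub>n\<^sub>,\<^sub>k\<close> cancel at \<open>2 k = n + 1\<close>.
  This is the case of no variables in \<open>complete_homogeneous_nth\<close>.
\<close>

lemma central_ballot_nth:
  "((1 + fps_X ^ 2) ^ n * (1 - fps_X ^ 2) :: real fps) $ Suc n = 0"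
proof (cases "even (Suc n)")
  case True
  then obtain l where "n = Suc (2 * l)"
    by (metis Suc_eq_plus1 even_Suc oddE)
  then have "c (int n) (int (Suc n div 2)) = 0"
    using binom_nat[of n l] binom_nat[of n "Suc l"] binomial_symmetric[of l n]
    by (simp add: c_def)
  then show ?thesis by (simp only: c_nth simp_thms if_cancel)
qed (simp add: c_nth)

lemma prod_quadratics_nth_0:
  fixes s :: nat
  shows "(\<Prod>j = 1..s. 1 + fps_X ^ 2 - fps_const (w j) * fps_X :: real fps) $ 0 = 1"
  by (induction s) (simp_all add: fps_power_zeroth)

text \<open>
  The case of \<open>t = x / (1 + x\<^sup>2)\<close> in Lagrange inversion, applied to \<open>1 / \<Prod>\<^sub>j (1 - w\<^sub>j t)\<close>. Write
  \<open>A\<^sub>s(n)\<close> for the right-hand side. In \<open>A\<^sub>s(n) - w\<^sub>s A\<^sub>s(n - 1)\<close> the two series combine with the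
  common factor \<open>(1 + x\<^sup>2) - w\<^sub>s x\<close>, which cancels the last factor of the denominator, so the
  difference is \<open>A\<^sub>s\<^sub>-\<^sub>1(n)\<close>. The exponent \<open>n + s - 1\<close> is truncated at \<open>n = s = 0\<close>, where only the
  constant term matters and every power of \<open>1 + x\<^sup>2\<close> gives the same value.
\<close>

lemma complete_homogeneous_nth:
  fixes w :: "nat \<Rightarrow> real"
  shows "complete_homogeneous s n w =
    ((1 + fps_X ^ 2) ^ (n + s - 1) * (1 - fps_X ^ 2) *
       inverse (\<Prod>j = 1..s. 1 + fps_X ^ 2 - fps_const (w j) * fps_X)) $ n"
proof (induction s arbitrary: n)
  case 0
  show ?case
    by (cases n) (simp_all add: complete_homogeneous_degree_0 complete_homogeneous_no_variables
        central_ballot_nth del: power_Suc)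
next
  case (Suc s)
  define b :: "real fps" where "b = 1 + fps_X ^ 2"
  define K :: "real fps" where "K = 1 - fps_X ^ 2"
  define D where "D s = (\<Prod>j = 1..s. b - fps_const (w j) * fps_X)" for s
  have D0: "D s $ 0 = 1" for s
    unfolding D_def b_def by (rule prod_quadratics_nth_0)
  have IH: "complete_homogeneous s n w = (b ^ (n + s - 1) * K * inverse (D s)) $ n" for n
    using Suc.IH[of n] by (simp add: b_def K_def D_def)
  have "complete_homogeneous (Suc s) n w = (b ^ (n + s) * K * inverse (D (Suc s))) $ n"
  proof (induction n)
    case 0
    show ?case
      by (simp add: complete_homogeneous_degree_0 D0 K_def b_def fps_power_zeroth)
  next
    case (Suc n)
    define a where "a = w (Suc s)"
    have cancel: "(b - fps_const a * fps_X) * inverse (D (Suc s)) = inverse (D s)"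
    proof -
      have "D (Suc s) = (b - fps_const a * fps_X) * D s"
        by (simp add: D_def a_def)
      moreover have "(b - fps_const a * fps_X) * inverse (b - fps_const a * fps_X) = 1"
        by (rule inverse_mult_eq_1') (simp add: b_def)
      ultimately show ?thesis
        by (simp add: fps_inverse_mult flip: mult.assoc)
    qed
    have "(b ^ (Suc n + s) * K * inverse (D (Suc s))) $ Suc n =
       (b ^ (n + s) * K * ((b - fps_const a * fps_X) * inverse (D (Suc s)))
        + fps_const a * (fps_X * (b ^ (n + s) * K * inverse (D (Suc s))))) $ Suc n"
      by (simp add: algebra_simps)
    also have "\<dots> = (b ^ (n + s) * K * inverse (D s)) $ Suc n
        + a * (b ^ (n + s) * K * inverse (D (Suc s))) $ n"
      by (simp add: cancel)
    also have "\<dots> = complete_homogeneous (Suc s) (Suc n) w"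
      by (simp add: complete_homogeneous_Suc_Suc IH Suc.IH a_def)
    finally show ?case ..
  qed
  then show ?case
    by (simp add: b_def K_def D_def)
qed

section \<open>The denominator at the cosines\<close>

text \<open>
  Both sides are polynomials of degree at most \<open>q = 2 r + 1\<close>, so agreement at \<open>q + 1\<close> points is
  enough. They both vanish at the \<open>q\<close> negated \<open>q\<close>-th roots of unity; the additional point is 0,
  where both are 1, and it takes the place of a comparison of leading coefficients.
\<close>

lemma cyclotomic_product:
  fixes z :: complex
  shows "(1 + z) * (\<Prod>j = 1..r. 1 + z ^ 2 - of_real (\<alpha> r j) * z) = 1 + z ^ (2 * r + 1)"
proof -
  define q where "q = 2 * r + 1"
  define p1 :: "complex poly" where
    "p1 = [:1, 1:] * (\<Prod>j = 1..r. [:1, - of_real (\<alpha> r j), 1:])"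
  define p2 :: "complex poly" where "p2 = 1 + monom 1 q"
  define \<omega> where "\<omega> k = cis (2 * pi * real k / real q)" for k
  have q: "q > 0" by (simp add: q_def)
  \<comment> \<open>The indices \<open>j\<close> and \<open>q - j\<close> give the conjugate pair of roots belonging to \<open>\<alpha>\<^sub>j\<close>.\<close>
  have factor: "1 + (- \<omega> k) ^ 2 + of_real (\<alpha> r j) * \<omega> k = 0"
    if "k = j \<or> k = q - j" "j \<le> r" for k j
  proof -
    have inv: "\<omega> j * \<omega> (q - j) = 1"
    proof -
      have "2 * pi * real j / real q + 2 * pi * real (q - j) / real q = 2 * pi"
        using that q by (simp add: q_def of_nat_diff flip: add_divide_distrib distrib_left)
      then show ?thesis by (simp add: \<omega>_def cis_mult)
    qed
    have "\<omega> (q - j) = cnj (\<omega> j)"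
      using inv by (metis \<omega>_def cis_cnj cis_inverse cis_neq_zero mult.commute
          inverse_unique)
    then have al: "of_real (\<alpha> r j) = - (\<omega> j + \<omega> (q - j))"
      by (simp add: \<alpha>_def \<omega>_def q_def complex_eq_iff add.commute)
    show ?thesis
      unfolding al using that(1) inv by (auto simp: algebra_simps power2_eq_square)
  qed
  have "p1 = p2"
  proof (rule poly_eqI_degree)
    fix x :: complex assume "x \<in> insert 0 (uminus ` {z. z ^ q = 1})"
    then consider "x = 0" | z where "z ^ q = 1" "x = - z" by blast
    then show "poly p1 x = poly p2 x"
    proof cases
      case 1
      then show ?thesis
        by (simp add: p1_def p2_def poly_prod poly_monom q_def)
    next
      case 2
      then obtain k where k: "k < q" "x = - \<omega> k"
        using bij_betw_roots_unity[of q] by (auto simp: bij_betw_def q_def \<omega>_def image_iff)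
      have "poly p1 x = 0"
      proof (cases "k = 0")
        case True
        then show ?thesis using k by (simp add: p1_def \<omega>_def)
      next
        case False
        define j where "j = (if k \<le> r then k else q - k)"
        have "j \<in> {1..r}" "k = j \<or> k = q - j"
          using False k by (auto simp: j_def q_def)
        then have "\<exists>j\<in>{1..r}. poly [:1, - of_real (\<alpha> r j), 1:] x = 0"
          using factor[of k j] k
          by (intro bexI[of _ j]) (auto simp: algebra_simps power2_eq_square)
        then have "(\<Prod>j = 1..r. poly [:1, - of_real (\<alpha> r j), 1:] x) = 0"
          by (intro prod_zero) auto
        then show ?thesis
          by (simp only: p1_def poly_mult poly_prod mult_zero_right)
      qed
      moreover have "poly p2 x = 0"
        using 2 by (simp add: p2_def poly_monom q_def)
      ultimately show ?thesis by simp
    qed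
  next
    have "card (uminus ` {z::complex. z ^ q = 1}) = q"
      by (subst card_image) (auto simp: card_roots_unity_eq q)
    moreover have "0 \<notin> uminus ` {z::complex. z ^ q = 1}"
      by (auto simp: q_def)
    moreover have "finite {z::complex. z ^ q = 1}"
      by (rule finite_roots_unity) (simp add: q_def)
    ultimately have card: "card (insert 0 (uminus ` {z::complex. z ^ q = 1})) = Suc q"
      by simp
    have "degree (\<Prod>j = 1..r. [:1, - complex_of_real (\<alpha> r j), 1:]) \<le> (\<Sum>j = 1..r. 2)"
      by (rule order.trans[OF degree_prod_sum_le]) auto
    then have "degree p1 \<le> q"
      unfolding p1_def q_def by (intro order.trans[OF degree_mult_le]) auto
    then show "degree p1 < card (insert 0 (uminus ` {z::complex. z ^ q = 1}))"
      using card by simp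
    have "degree p2 \<le> q"
      unfolding p2_def by (intro degree_add_le) (auto simp: degree_monom_le)
    then show "degree p2 < card (insert 0 (uminus ` {z::complex. z ^ q = 1}))"
      using card by simp
  qed
  then have "poly p1 z = poly p2 z" by simp
  then show ?thesis
    by (simp add: p1_def p2_def poly_prod poly_monom q_def algebra_simps power2_eq_square)
qed

text \<open>
  The complex identity, restricted to real arguments, is an identity of real polynomial
  functions and therefore one of polynomials and of power series.
\<close>

lemma cyclotomic_product_fps:
  "(1 + fps_X) * (\<Prod>j = 1..r. 1 + fps_X ^ 2 - fps_const (\<alpha> r j) * fps_X) =
     (1 + fps_X ^ (2 * r + 1) :: real fps)"
proof -
  define p1 where "p1 = [:1, 1:] * (\<Prod>j = 1..r. [:1, - \<alpha> r j, 1:])"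
  define p2 :: "real poly" where "p2 = 1 + monom 1 (2 * r + 1)"
  have "poly p1 x = poly p2 x" for x
  proof -
    have "complex_of_real ((1 + x) * (\<Prod>j = 1..r. 1 + x ^ 2 - \<alpha> r j * x)) =
        complex_of_real (1 + x ^ (2 * r + 1))"
      using cyclotomic_product[of "of_real x" r] by simp
    then have "(1 + x) * (\<Prod>j = 1..r. 1 + x ^ 2 - \<alpha> r j * x) = 1 + x ^ (2 * r + 1)"
      by (simp only: of_real_eq_iff)
    then show ?thesis
      by (simp add: p1_def p2_def poly_prod poly_monom algebra_simps power2_eq_square)
  qed
  then have "p1 = p2"
    by (simp add: poly_eq_poly_eq_iff[symmetric] fun_eq_iff)
  then have "fps_of_poly p1 = fps_of_poly p2" by simp
  then show ?thesis
    by (simp add: p1_def p2_def fps_of_poly_mult fps_of_poly_prod fps_of_poly_add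
        fps_of_poly_monom' fps_of_poly_pCons algebra_simps power2_eq_square
        del: fps_const_neg flip: fps_const_neg)
qed

lemma signed_residue_series:
  fixes q :: nat
  assumes "q \<ge> 2"
  shows "(1 + fps_X) * inverse (1 + fps_X ^ q) =
    Abs_fps (\<lambda>m. if m mod q \<le> 1 then (-1) ^ (m div q) else 0 :: real)"
proof -
  define g where "g = (\<lambda>m. if m mod q \<le> 1 then (-1) ^ (m div q) else 0 :: real)"
  have "Abs_fps g * (1 + fps_X ^ q) = 1 + fps_X"
  proof (rule fps_ext)
    fix m
    have "(Abs_fps g * (1 + fps_X ^ q)) $ m = g m + (if m < q then 0 else g (m - q))"
      by (simp add: algebra_simps fps_X_power_mult_right_nth)
    also have "\<dots> = (1 + fps_X) $ m"
    proof (cases "m < q")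
      case True
      then show ?thesis by (auto simp: g_def)
    next
      case False
      then show ?thesis
        using assms by (auto simp: g_def le_mod_geq le_div_geq)
    qed
    finally show "(Abs_fps g * (1 + fps_X ^ q)) $ m = (1 + fps_X) $ m" .
  qed
  moreover have "(1 + fps_X ^ q) * inverse (1 + fps_X ^ q :: real fps) = 1"
    by (rule inverse_mult_eq_1') (use assms in simp)
  ultimately show ?thesis
    unfolding g_def[symmetric] by (metis mult.assoc mult.right_neutral)
qed

section \<open>Power sums\<close>

lemma sum_cis_multiples:
  fixes q :: nat and a :: int
  assumes "q > 0"
  shows "(\<Sum>j<q. cis (of_int a * (2 * pi * real j / real q))) =
    of_nat q * of_bool (int q dvd a)"
proof -
  define \<zeta> where "\<zeta> = cis (2 * pi * of_int a / real q)"
  have geom: "(\<Sum>j<q. cis (of_int a * (2 * pi * real j / real q))) = (\<Sum>j<q. \<zeta> ^ j)"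
    by (simp add: \<zeta>_def DeMoivre mult_ac)
  have "\<zeta> = 1 \<longleftrightarrow> int q dvd a"
  proof
    assume "int q dvd a"
    then obtain b where "a = int q * b" by (auto elim: dvdE)
    then have "2 * pi * of_int a / real q = 2 * pi * of_int b"
      using assms by simp
    then show "\<zeta> = 1"
      unfolding \<zeta>_def by (simp add: cis_multiple_2pi)
  next
    assume "\<zeta> = 1"
    then have "cos (2 * pi * of_int a / real q) = 1"
      by (simp add: \<zeta>_def complex_eq_iff)
    then obtain b :: int where "2 * pi * of_int a / real q = of_int b * 2 * pi"
      by (auto simp: cos_one_2pi_int)
    then have "real_of_int a = real_of_int (b * int q)"
      using assms by (simp add: field_simps)
    then show "int q dvd a"
      by (simp only: of_int_eq_iff) simp
  qed
  moreover have "\<zeta> ^ q = 1"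
    using assms cis_multiple_2pi[of "of_int a"] by (simp add: \<zeta>_def DeMoivre)
  ultimately show ?thesis
    unfolding geom by (cases "\<zeta> = 1") (simp_all add: sum_gp_strict)
qed

lemma sum_cosine_powers:
  fixes q n :: nat
  assumes "q > 0"
  shows "(\<Sum>j<q. (2 * cos (2 * pi * real j / real q)) ^ n) =
    real q * (\<Sum>k\<le>n. real (n choose k) * of_bool (int q dvd int n - 2 * int k))"
proof -
  define \<theta> where "\<theta> j = 2 * pi * real j / real q" for j
  have binomial: "complex_of_real ((2 * cos t) ^ n) =
      (\<Sum>k\<le>n. of_nat (n choose k) * cis (of_int (int n - 2 * int k) * t))" for t
  proof -
    have "complex_of_real (2 * cos t) = cis (- t) + cis t"
      by (simp add: complex_eq_iff)
    then have "complex_of_real ((2 * cos t) ^ n) = (cis (- t) + cis t) ^ n"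
      by (metis of_real_power)
    also have "\<dots> = (\<Sum>k\<le>n. of_nat (n choose k) * cis (- t) ^ k * cis t ^ (n - k))"
      by (rule binomial_ring)
    also have "\<dots> = (\<Sum>k\<le>n. of_nat (n choose k) * cis (of_int (int n - 2 * int k) * t))"
      by (intro sum.cong refl)
        (simp add: DeMoivre cis_mult mult.assoc of_nat_diff algebra_simps)
    finally show ?thesis .
  qed
  have "complex_of_real (\<Sum>j<q. (2 * cos (\<theta> j)) ^ n) =
      (\<Sum>j<q. \<Sum>k\<le>n. of_nat (n choose k) * cis (of_int (int n - 2 * int k) * \<theta> j))"
    unfolding of_real_sum binomial ..
  also have "\<dots> = (\<Sum>k\<le>n. of_nat (n choose k) *
      (\<Sum>j<q. cis (of_int (int n - 2 * int k) * \<theta> j)))"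
    unfolding sum_distrib_left by (rule sum.swap)
  also have "\<dots> = (\<Sum>k\<le>n. of_nat (n choose k) *
      (of_nat q * of_bool (int q dvd int n - 2 * int k)))"
    unfolding \<theta>_def sum_cis_multiples[OF assms] ..
  also have "\<dots> = complex_of_real (real q *
      (\<Sum>k\<le>n. real (n choose k) * of_bool (int q dvd int n - 2 * int k)))"
    unfolding of_real_mult of_real_sum sum_distrib_left
    by (intro sum.cong refl) (simp add: mult_ac)
  finally show ?thesis
    unfolding of_real_eq_iff \<theta>_def .
qed

text \<open>
  The angles of index \<open>j\<close> and \<open>2 r + 1 - j\<close> have the same cosine, so each \<open>\<alpha>\<^sub>j\<close> is counted twice;
  the sign in \<open>\<alpha>\<^sub>j\<close> produces \<open>(-1)\<^sup>n\<close>, and the angle 0 produces \<open>2\<^sup>n\<close>.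
\<close>

lemma sum_cosine_powers_fold:
  "(\<Sum>j<2 * r + 1. (2 * cos (2 * pi * real j / (2 * real r + 1))) ^ n) =
     2 ^ n + 2 * ((-1) ^ n * L r n)"
proof -
  define f where "f j = (2 * cos (2 * pi * real j / (2 * real r + 1))) ^ n" for j
  have reflect: "f (2 * r + 1 - j) = f j" if "j \<le> 2 * r + 1" for j
  proof -
    have "2 * pi * real (2 * r + 1 - j) / (2 * real r + 1) =
        2 * pi - 2 * pi * real j / (2 * real r + 1)"
      using that by (simp add: of_nat_diff field_simps)
    then show ?thesis by (simp add: f_def cos_diff)
  qed
  have half: "sum f {1..r} = (-1) ^ n * L r n"
  proof -
    have "f j = (-1) ^ n * \<alpha> r j ^ n" for j
    proof -
      have "f j = (- 1 * \<alpha> r j) ^ n" by (simp add: f_def \<alpha>_def)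
      then show ?thesis by (simp only: power_mult_distrib)
    qed
    then show ?thesis
      by (simp add: L_def power_sum_def sum_distrib_left)
  qed
  have other: "sum f {r+1..2*r} = sum f {1..r}"
    by (rule sum.reindex_bij_witness[where i = "\<lambda>j. 2 * r + 1 - j" and j = "\<lambda>j. 2 * r + 1 - j"])
      (auto simp: reflect[simplified])
  have "{..<2 * r + 1} = insert 0 ({1..r} \<union> {r+1..2*r})" by auto
  then have "sum f {..<2 * r + 1} = f 0 + sum f ({1..r} \<union> {r+1..2*r})" by simp
  also have "sum f ({1..r} \<union> {r+1..2*r}) = sum f {1..r} + sum f {r+1..2*r}"
    by (rule sum.union_disjoint) auto
  finally show ?thesis
    unfolding other half by (simp add: f_def)
qed

lemma L_closed_form:
  "L r n = (-1) ^ n * ((2 * real r + 1) / 2 *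
      (\<Sum>k::int = 0..int n. binom (int n) k * of_bool (2 * int r + 1 dvd int n - 2 * k))
      - 2 powi (int n - 1))"
proof -
  define S where "S = (\<Sum>k::int = 0..int n. binom (int n) k *
      of_bool (2 * int r + 1 dvd int n - 2 * k))"
  have "S = (\<Sum>k\<le>n. real (n choose k) * of_bool (2 * int r + 1 dvd int n - 2 * int k))"
    unfolding S_def
    by (rule sum.reindex_bij_witness[where i = int and j = nat]) (auto simp flip: binom_nat)
  then have "(2 * real r + 1) * S = 2 ^ n + 2 * ((-1) ^ n * L r n)"
    using sum_cosine_powers[of "2 * r + 1" n] sum_cosine_powers_fold[of r n]
    by (simp add: add.commute)
  moreover have "(2::real) ^ n = 2 * 2 powi (int n - 1)"
    by (simp add: power_int_diff)
  ultimately have "(-1) ^ n * L r n = (2 * real r + 1) / 2 * S - 2 powi (int n - 1)"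
    by (simp add: algebra_simps)
  then have "(-1) ^ n * ((-1) ^ n * L r n) = (-1) ^ n * ((2 * real r + 1) / 2 * S - 2 powi (int n - 1))"
    by simp
  then show ?thesis
    unfolding S_def by (simp only: mult.assoc[symmetric] power_mult_distrib[symmetric]) simp
qed

text \<open>
  Turns a divisibility condition on the summation index into a sum over the integer parameter
  of the residue class; the bounds are those for which \<open>a - q k\<close> stays in \<open>{0..N}\<close>.
\<close>

lemma sum_residue_class:
  fixes q a N :: int and f :: "int \<Rightarrow> real"
  assumes "q > 0"
  shows "(\<Sum>i = 0..N. f i * of_bool (q dvd a - i)) =
    (\<Sum>k = - ((N - a) div q)..a div q. f (a - q * k))"
proof -
  have le_div: "k \<le> x div q \<longleftrightarrow> q * k \<le> x" for k x
  proof
    assume "k \<le> x div q"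
    then have "q * k \<le> q * (x div q)" using assms by simp
    also have "\<dots> \<le> x"
      using assms by (metis add.commute mult_div_mod_eq le_add_same_cancel2 pos_mod_sign)
    finally show "q * k \<le> x" .
  next
    assume "q * k \<le> x"
    then have "q * k div q \<le> x div q" using assms by (intro zdiv_mono1)
    then show "k \<le> x div q" using assms by simp
  qed
  have neg_le: "- (x div q) \<le> k \<longleftrightarrow> - (q * k) \<le> x" for k x
    using le_div[of "- k" x] by auto
  have "(\<Sum>i = 0..N. f i * of_bool (q dvd a - i)) = (\<Sum>i\<in>{i\<in>{0..N}. q dvd a - i}. f i)"
    by (intro sum.mono_neutral_cong_right) auto
  also have "\<dots> = (\<Sum>k\<in>{k. q * k \<le> a \<and> - (q * k) \<le> N - a}. f (a - q * k))"
    by (rule sum.reindex_bij_witness[where i = "\<lambda>k. a - q * k" and j = "\<lambda>i. (a - i) div q"])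
      (use assms in auto)
  also have "{k. q * k \<le> a \<and> - (q * k) \<le> N - a} = {- ((N - a) div q)..a div q}"
    unfolding set_eq_iff atLeastAtMost_iff le_div neg_le by auto
  finally show ?thesis .
qed

section \<open>The formulas for the Fibonacci-type numbers\<close>

lemma F_convolution:
  assumes "r \<ge> 1"
  shows "F r (Suc N) = (\<Sum>i\<le>N.
    (if even i then c (int (N + r - 1)) (int (i div 2)) else 0) *
    (if (N - i) mod (2 * r + 1) \<le> 1 then (-1) ^ ((N - i) div (2 * r + 1)) else 0))"
proof -
  define q where "q = 2 * r + 1"
  define D where "D = (\<Prod>j = 1..r. 1 + fps_X ^ 2 - fps_const (\<alpha> r j) * fps_X)"
  have "D $ 0 = 1"
    unfolding D_def by (rule prod_quadratics_nth_0)
  then have D: "D * inverse D = 1"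
    by (intro inverse_mult_eq_1') simp
  have Q: "(1 + fps_X) * D = 1 + fps_X ^ q"
    unfolding D_def q_def by (rule cyclotomic_product_fps)
  have "(1 + fps_X ^ q) * inverse (1 + fps_X ^ q :: real fps) = 1"
    by (rule inverse_mult_eq_1') (simp add: q_def)
  then have "inverse D = (1 + fps_X) * inverse (1 + fps_X ^ q)"
    unfolding Q[symmetric] using D by (metis (no_types, lifting) mult.assoc mult.commute mult.right_neutral)
  also have "\<dots> = Abs_fps (\<lambda>m. if m mod q \<le> 1 then (-1) ^ (m div q) else 0)"
    by (rule signed_residue_series) (use assms in \<open>simp add: q_def\<close>)
  finally have inv: "inverse D = Abs_fps (\<lambda>m. if m mod q \<le> 1 then (-1) ^ (m div q) else 0)" .
  have "F r (Suc N) =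
      ((1 + fps_X ^ 2) ^ (N + r - 1) * (1 - fps_X ^ 2) * inverse D) $ N"
    by (simp only: F_def complete_homogeneous_nth D_def diff_Suc_1)
  also have "\<dots> = (\<Sum>i\<le>N. (if even i then c (int (N + r - 1)) (int (i div 2)) else 0) *
      (if (N - i) mod q \<le> 1 then (-1) ^ ((N - i) div q) else 0))"
    unfolding fps_mult_nth[of _ "inverse D" N] unfolding inv c_nth fps_nth_Abs_fps atMost_atLeast0 ..
  finally show ?thesis
    unfolding q_def .
qed

text \<open>
  Stepping back by 2 crosses a multiple of \<open>q\<close> exactly when the residue is 0 or 1. This is
  how the summand of the first formula encodes the coefficients of \<open>(1 + x) / (1 + x\<^sup>q)\<close>.
\<close>

lemma half_difference_of_signs:
  fixes m q :: int
  assumes "q \<ge> 2"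
  shows "1 / 2 * ((-1) powi (m div q) - (-1) powi ((m - 2) div q)) =
    (if m mod q \<le> 1 then (-1) powi (m div q) else 0 :: real)"
proof (cases "m mod q \<le> 1")
  case True
  have "m - 2 = q * (m div q - 1) + (m mod q + q - 2)"
    by (simp add: algebra_simps)
  moreover have "0 \<le> m mod q + q - 2" "m mod q + q - 2 < q"
    using assms True pos_mod_sign[of q m] by linarith+
  ultimately have "(m - 2) div q = m div q - 1"
    by (rule int_div_pos_eq)
  then show ?thesis using True by (simp add: power_int_diff)
next
  case False
  have "m - 2 = q * (m div q) + (m mod q - 2)"
    by simp
  moreover have "0 \<le> m mod q - 2" "m mod q - 2 < q"
    using assms False pos_mod_bound[of q m] by linarith+
  ultimately have "(m - 2) div q = m div q"
    by (rule int_div_pos_eq)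
  then show ?thesis using False by simp
qed

lemma F_first_formula:
  assumes "r \<ge> 1"
  shows "F r (Suc N) = (\<Sum>k = 0..int N div 2.
    1 / 2 * ((-1) powi ((int N - 2 * k) div (2 * int r + 1)) -
             (-1) powi ((int N - 2 * k - 2) div (2 * int r + 1)))
    * c (int (N + r - 1)) k)"
proof -
  define q where "q = 2 * r + 1"
  define g :: "nat \<Rightarrow> real" where "g m = (if m mod q \<le> 1 then (-1) ^ (m div q) else 0)" for m
  have g: "1 / 2 * ((-1) powi ((int N - 2 * k) div (2 * int r + 1)) -
      (-1) powi ((int N - 2 * k - 2) div (2 * int r + 1))) = g (N - nat (2 * k))"
    if "0 \<le> k" "k \<le> int N div 2" for k
  proof -
    have N: "int N - 2 * k = int (N - nat (2 * k))" and q: "2 * int r + 1 = int q"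
      using that by (auto simp: q_def)
    have "int q \<ge> 2" using assms by (simp add: q_def)
    from half_difference_of_signs[OF this, of "int (N - nat (2 * k))"] show ?thesis
      unfolding N q by (simp add: g_def flip: zdiv_int zmod_int)
  qed
  have "F r (Suc N) = (\<Sum>i\<le>N. (if even i then c (int (N + r - 1)) (int (i div 2)) else 0) * g (N - i))"
    unfolding g_def q_def by (rule F_convolution[OF assms])
  also have "\<dots> = (\<Sum>i\<in>{i\<in>{..N}. even i}. c (int (N + r - 1)) (int (i div 2)) * g (N - i))"
    by (intro sum.mono_neutral_cong_right) auto
  also have "\<dots> = (\<Sum>k = 0..int N div 2. c (int (N + r - 1)) k * g (N - nat (2 * k)))"
    by (rule sum.reindex_bij_witness[where i = "\<lambda>k. nat (2 * k)" and j = "\<lambda>i. int (i div 2)"])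
      (auto simp: nat_mult_distrib zdiv_int intro: zdiv_mono1)
  also have "\<dots> = (\<Sum>k = 0..int N div 2.
    1 / 2 * ((-1) powi ((int N - 2 * k) div (2 * int r + 1)) -
             (-1) powi ((int N - 2 * k - 2) div (2 * int r + 1)))
    * c (int (N + r - 1)) k)"
  proof (intro sum.cong refl)
    fix k assume "k \<in> {0..int N div 2}"
    then show "c (int (N + r - 1)) k * g (N - nat (2 * k)) =
      1 / 2 * ((-1) powi ((int N - 2 * k) div (2 * int r + 1)) -
               (-1) powi ((int N - 2 * k - 2) div (2 * int r + 1)))
      * c (int (N + r - 1)) k"
      by (subst g) auto
  qed
  finally show ?thesis .
qed

text \<open>
  The \<open>k\<close>-th period of \<open>(1 + x) / (1 + x\<^sup>q)\<close> has nonzero coefficients at \<open>q k\<close> and \<open>q k + 1\<close> only.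
  Exactly one of \<open>N - q k\<close> and \<open>N - q k - 1\<close> is even, so each \<open>k\<close> contributes one term, with
  \<open>(1 + x\<^sup>2)\<^sup>M (1 - x\<^sup>2)\<close> (for \<open>M = N + r - 1\<close>) evaluated at the even one, which is
  \<open>2 ((N - q k) div 2)\<close>.
\<close>

lemma F_second_formula:
  assumes "r \<ge> 1"
  shows "F r (Suc N) = (\<Sum>k = 0..int N div (2 * int r + 1).
    (-1) powi k * c (int (N + r - 1)) ((int N - (2 * int r + 1) * k) div 2))"
proof -
  define q where "q = 2 * r + 1"
  define C where "C = c (int (N + r - 1))"
  have q: "2 * int r + 1 = int q" and q3: "q \<ge> 3" using assms by (auto simp: q_def)
  have "F r (Suc N) = (\<Sum>i\<le>N. (if even i then C (int (i div 2)) else 0) *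
      (if (N - i) mod q \<le> 1 then (-1) ^ ((N - i) div q) else 0))"
    unfolding C_def q_def by (rule F_convolution[OF assms])
  also have "\<dots> = (\<Sum>i\<in>{i\<in>{..N}. even i \<and> (N - i) mod q \<le> 1}.
      (-1) ^ ((N - i) div q) * C (int (i div 2)))"
    by (intro sum.mono_neutral_cong_right) auto
  also have "\<dots> = (\<Sum>k\<le>N div q. (-1) ^ k * C (int ((N - q * k) div 2)))"
  proof (rule sum.reindex_bij_witness[where j = "\<lambda>i. (N - i) div q" and
        i = "\<lambda>k. 2 * ((N - q * k) div 2)"])
    fix i assume "i \<in> {i\<in>{..N}. even i \<and> (N - i) mod q \<le> 1}"
    then have i: "i \<le> N" "even i" "(N - i) mod q \<le> 1" by auto
    have "N - i = q * ((N - i) div q) + (N - i) mod q" by simp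
    then have "N - q * ((N - i) div q) = i + (N - i) mod q"
      using i(1) by linarith
    then have *: "(N - q * ((N - i) div q)) div 2 = i div 2"
      using i(2,3) by (auto elim!: evenE simp: le_Suc_eq)
    then show "2 * ((N - q * ((N - i) div q)) div 2) = i"
      using i(2) by simp
    show "(N - i) div q \<in> {..N div q}"
      by (auto intro: div_le_mono)
    show "(- 1) ^ ((N - i) div q) * C (int ((N - q * ((N - i) div q)) div 2)) =
        (- 1) ^ ((N - i) div q) * C (int (i div 2))"
      by (simp only: *)
  next
    fix k assume "k \<in> {..N div q}"
    then have k: "q * k \<le> N"
      by (metis atMost_iff div_times_less_eq_dividend le_trans mult.commute mult_le_mono1)
    define s where "s = (N - q * k) mod 2"
    have "N - q * k = 2 * ((N - q * k) div 2) + s" by (simp add: s_def)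
    then have eq: "N - 2 * ((N - q * k) div 2) = q * k + s"
      using k by linarith
    have "s \<le> 1" by (simp add: s_def)
    then have s: "s < q" using q3 by simp
    show "(N - 2 * ((N - q * k) div 2)) div q = k"
      unfolding eq using s by simp
    have "(N - 2 * ((N - q * k) div 2)) mod q = s"
      unfolding eq using s by simp
    then show "2 * ((N - q * k) div 2) \<in> {i\<in>{..N}. even i \<and> (N - i) mod q \<le> 1}"
      using \<open>s \<le> 1\<close> by (auto intro: order.trans[OF div_times_less_eq_dividend] simp: mult.commute)
  qed
  also have "\<dots> = (\<Sum>k = 0..int N div int q. (-1) powi k * C ((int N - int q * k) div 2))"
  proof (rule sum.reindex_bij_witness[where i = nat and j = int])
    fix k assume "k \<in> {..N div q}"
    then have k: "q * k \<le> N"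
      by (metis atMost_iff div_times_less_eq_dividend le_trans mult.commute mult_le_mono1)
    then have "(int N - int q * int k) div 2 = int ((N - q * k) div 2)"
      by (simp add: zdiv_int of_nat_diff)
    then show "(-1) powi int k * C ((int N - int q * int k) div 2) =
        (-1) ^ k * C (int ((N - q * k) div 2))"
      by simp
  qed (auto simp flip: zdiv_int)
  finally show ?thesis
    unfolding C_def q .
qed

section \<open>The closed forms\<close>

theorem theorem3:
  fixes r :: nat
  assumes "r \<ge> 1"
  shows
    "(\<forall>n::nat. n \<ge> 1 \<longrightarrow>
        F r n =
          (\<Sum>k::int = 0..\<lfloor>(real n - 1) / 2\<rfloor>.
             1 / 2 *
             ((-1) powi \<lfloor>(real n - 1 - 2 * real_of_int k) / (2 * real r + 1)\<rfloor>
              - (-1) powi \<lfloor>(real n - 2 * real_of_int k - 3) / (2 * real r + 1)\<rfloor>)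
             * c (int n + int r - 2) k) \<and>
        F r n =
          (\<Sum>k::int = 0..\<lfloor>(real n - 1) / (2 * real r + 1)\<rfloor>.
             (-1) powi k *
             c (int n + int r - 2) \<lfloor>(real n - 1 - (2 * real r + 1) * real_of_int k) / 2\<rfloor>)) \<and>
     (\<forall>n::nat.
        L r n =
          (-1) ^ (n + 1) * 2 powi (int n - 1)
          + (-1) ^ n * ((2 * real r + 1) / 2) *
            (\<Sum>k::int = 0..int n.
               binom (int n) k * of_bool (2 * int r + 1 dvd int n - 2 * k)) \<and>
        (\<forall>m::nat. n = 2 * m \<longrightarrow>
           L r n =
             - (2 powi (2 * int m - 1))
             + (2 * real r + 1) / 2 *
               (\<Sum>k::int = - \<lfloor>real m / (2 * real r + 1)\<rfloor>..\<lfloor>real m / (2 * real r + 1)\<rfloor>.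
                  binom (2 * int m) (int m - (2 * int r + 1) * k))) \<and>
        (\<forall>m::nat. n = 2 * m + 1 \<longrightarrow>
           L r n =
             4 ^ m
             - (2 * real r + 1) / 2 *
               (\<Sum>k::int = - \<lfloor>(real m + real r + 1) / (2 * real r + 1)\<rfloor>..
                           \<lfloor>(real m - real r) / (2 * real r + 1)\<rfloor>.
                  binom (2 * int m + 1) (int m - (2 * int r + 1) * k - int r))))"
proof -
  define q where "q = 2 * int r + 1"
  have floor_div: "\<lfloor>x / y\<rfloor> = a div b" if "x = real_of_int a" "y = real_of_int b" for x y a b
    using that by (simp add: floor_divide_of_int_eq)
  have dvd_double: "q dvd 2 * x \<longleftrightarrow> q dvd x" for x
  proof -
    have "coprime q 2" by (simp add: q_def)
    then show ?thesis by (rule coprime_dvd_mult_right_iff)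
  qed
  have F1: "F r n = (\<Sum>k::int = 0..\<lfloor>(real n - 1) / 2\<rfloor>.
      1 / 2 * ((-1) powi \<lfloor>(real n - 1 - 2 * real_of_int k) / (2 * real r + 1)\<rfloor>
              - (-1) powi \<lfloor>(real n - 2 * real_of_int k - 3) / (2 * real r + 1)\<rfloor>)
             * c (int n + int r - 2) k)"
    and F2: "F r n = (\<Sum>k::int = 0..\<lfloor>(real n - 1) / (2 * real r + 1)\<rfloor>.
             (-1) powi k *
             c (int n + int r - 2) \<lfloor>(real n - 1 - (2 * real r + 1) * real_of_int k) / 2\<rfloor>)"
    if pos: "n \<ge> 1" for n
  proof -
    obtain N where n: "n = Suc N" using pos by (cases n) auto
    have cN: "int n + int r - 2 = int (N + r - 1)" using assms by (simp add: n)
    have fl: "\<lfloor>(real n - 1) / 2\<rfloor> = int N div 2"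
      "\<lfloor>(real n - 1) / (2 * real r + 1)\<rfloor> = int N div (2 * int r + 1)"
      "\<lfloor>(real n - 1 - 2 * real_of_int k) / (2 * real r + 1)\<rfloor> = (int N - 2 * k) div (2 * int r + 1)"
      "\<lfloor>(real n - 2 * real_of_int k - 3) / (2 * real r + 1)\<rfloor> = (int N - 2 * k - 2) div (2 * int r + 1)"
      "\<lfloor>(real n - 1 - (2 * real r + 1) * real_of_int k) / 2\<rfloor> = (int N - (2 * int r + 1) * k) div 2"
      for k
      by (rule floor_div; simp add: n)+
    show "F r n = (\<Sum>k::int = 0..\<lfloor>(real n - 1) / 2\<rfloor>.
      1 / 2 * ((-1) powi \<lfloor>(real n - 1 - 2 * real_of_int k) / (2 * real r + 1)\<rfloor>
              - (-1) powi \<lfloor>(real n - 2 * real_of_int k - 3) / (2 * real r + 1)\<rfloor>)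
             * c (int n + int r - 2) k)"
      unfolding fl cN unfolding n by (rule F_first_formula[OF assms])
    show "F r n = (\<Sum>k::int = 0..\<lfloor>(real n - 1) / (2 * real r + 1)\<rfloor>.
             (-1) powi k *
             c (int n + int r - 2) \<lfloor>(real n - 1 - (2 * real r + 1) * real_of_int k) / 2\<rfloor>)"
      unfolding fl cN unfolding n by (rule F_second_formula[OF assms])
  qed
  have L1: "L r n = (-1) ^ (n + 1) * 2 powi (int n - 1)
          + (-1) ^ n * ((2 * real r + 1) / 2) *
            (\<Sum>k::int = 0..int n.
               binom (int n) k * of_bool (2 * int r + 1 dvd int n - 2 * k))" for n
    unfolding L_closed_form by (simp add: right_diff_distrib mult.assoc)
  \<comment> \<open>For \<open>n = 2 m\<close> the residue class is that of \<open>m\<close> modulo \<open>q\<close>.\<close>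
  have L2: "L r n = - (2 powi (2 * int m - 1))
             + (2 * real r + 1) / 2 *
               (\<Sum>k::int = - \<lfloor>real m / (2 * real r + 1)\<rfloor>..\<lfloor>real m / (2 * real r + 1)\<rfloor>.
                  binom (2 * int m) (int m - (2 * int r + 1) * k))"
    if n: "n = 2 * m" for n m
  proof -
    have fl: "\<lfloor>real m / (2 * real r + 1)\<rfloor> = int m div q"
      by (rule floor_div) (simp_all add: q_def)
    have "q dvd 2 * int m - 2 * k \<longleftrightarrow> q dvd int m - k" for k
      using dvd_double[of "int m - k"] by (simp add: right_diff_distrib)
    moreover have "q > 0" by (simp add: q_def)
    ultimately show ?thesis
      using sum_residue_class[of q "binom (2 * int m)" "int m" "2 * int m"]
      unfolding L_closed_form n fl q_def[symmetric] by simp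
  qed
  \<comment> \<open>For \<open>n = 2 m + 1\<close> it is that of \<open>m - r\<close>, because \<open>n - 2 (m - r) = q\<close>.\<close>
  have L3: "L r n = 4 ^ m
             - (2 * real r + 1) / 2 *
               (\<Sum>k::int = - \<lfloor>(real m + real r + 1) / (2 * real r + 1)\<rfloor>..
                           \<lfloor>(real m - real r) / (2 * real r + 1)\<rfloor>.
                  binom (2 * int m + 1) (int m - (2 * int r + 1) * k - int r))"
    if n: "n = 2 * m + 1" for n m
  proof -
    have fl: "\<lfloor>(real m + real r + 1) / (2 * real r + 1)\<rfloor> = (2 * int m + 1 - (int m - int r)) div q"
      "\<lfloor>(real m - real r) / (2 * real r + 1)\<rfloor> = (int m - int r) div q"
      by (rule floor_div; simp add: q_def)+
    have dvd: "q dvd 2 * int m + 1 - 2 * k \<longleftrightarrow> q dvd (int m - int r) - k" for k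
    proof -
      have "2 * int m + 1 - 2 * k = 2 * ((int m - int r) - k) + q"
        by (simp add: q_def)
      then show ?thesis
        by (simp only: dvd_add_left_iff[OF dvd_refl] dvd_double)
    qed
    have arg: "int m - q * k - int r = (int m - int r) - q * k" for k by simp
    have "q > 0" by (simp add: q_def)
    from sum_residue_class[OF this, of "binom (2 * int m + 1)" "int m - int r" "2 * int m + 1"]
    have S: "(\<Sum>k = 0..2 * int m + 1. binom (2 * int m + 1) k *
        of_bool (q dvd 2 * int m + 1 - 2 * k)) =
      (\<Sum>k = - ((2 * int m + 1 - (int m - int r)) div q)..(int m - int r) div q.
        binom (2 * int m + 1) (int m - q * k - int r))"
      unfolding dvd arg .
    have int_n: "int (2 * m + 1) = 2 * int m + 1" by simp
    have pow: "(-1) ^ (2 * m + 1) = (-1 :: real)" "2 powi (2 * int m + 1 - 1) = (4 ^ m :: real)"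
      using power_int_of_nat[of "2::real" "2 * m"] by (simp_all add: power_mult)
    show ?thesis
      unfolding L_closed_form n fl q_def[symmetric] int_n S pow by simp
  qed
  show ?thesis
    using F1 F2 L1 L2 L3 by blast
qed

end
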